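(* Let $q$ be a power of a prime and $m$ a positive integer. If every prime factor of $q-1$ divides $m$, then, for every element $c \in \mathbb{F}_q^*$, the number $Z_{q,m,q^m-1}(c)$ of primitive elements $\xi \in \mathbb{F}_{q^m}$ with $\operatorname{Tr}_{\mathbb{F}_{q^m}/\mathbb{F}_q}(\xi) = c$ is given by $$Z_{q,m,q^m-1}(c) = \frac{\phi(q^m-1) - Z_{q,m,q^m-1}(0)}{q-1}.$$
   Context: $\phi$ is Euler's function. A primitive element of $\mathbb{F}_{q^m}$ is a generator of the multiplicative group $\mathbb{F}_{q^m}^*$. For $c \in \mathbb{F}_q$ (including $c = 0$), $Z_{q,m,q^m-1}(c)$ denotes the number of primitive elements $\xi$ of $\mathbb{F}_{q^m}$ with $\operatorname{Tr}_{\mathbb{F}_{q^m}/\mathbb{F}_q}(\xi) = c$. *)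

theory Defs
  imports
    "HOL-Algebra.Subrings"
    "HOL-Algebra.Generated_Groups"
    "HOL-Algebra.Multiplicative_Group"
    "HOL-Number_Theory.Totient"
    "HOL-Number_Theory.Prime_Powers"
begin

(* HOL-Algebra has two copies of mult_of, hence the qualified name. *)
definition primitive_element :: "('a, 'b) ring_scheme \<Rightarrow> 'a \<Rightarrow> bool" where
  "primitive_element L x \<longleftrightarrow>
     x \<in> carrier (Multiplicative_Group.mult_of L) \<and>
     generate (Multiplicative_Group.mult_of L) {x} = carrier (Multiplicative_Group.mult_of L)"

(* Tr(x) = x + x^q + ... + x^(q^(m-1)), the usual definition of the trace for finite fields:
   the sum of the conjugates of x over the subfield with q elements, where L has q^m elements. *)
definition ff_trace :: "('a, 'b) ring_scheme \<Rightarrow> nat \<Rightarrow> nat \<Rightarrow> 'a \<Rightarrow> 'a" where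
  "ff_trace L q m x = (\<Oplus>\<^bsub>L\<^esub>i\<in>{..<m}. x [^]\<^bsub>L\<^esub> (q ^ i))"

(* Z_{q,m,q^m-1}(c) *)
definition Z_primitive :: "('a, 'b) ring_scheme \<Rightarrow> nat \<Rightarrow> nat \<Rightarrow> 'a \<Rightarrow> nat" where
  "Z_primitive L q m c = card {x \<in> carrier L. primitive_element L x \<and> ff_trace L q m x = c}"

end

theory Submission
  imports Defs
begin

text \<open>
  Multiplication by an element \<open>a\<close> of \<open>K\<^sup>*\<close> permutes the primitive elements, and this is where the
  condition on the prime factors of \<open>q - 1\<close> enters. Put \<open>e = 1 + q + \<dots> + q ^ (m - 1)\<close>, so that
  \<open>q ^ m - 1 = (q - 1) e\<close>. A prime factor of \<open>q - 1\<close> divides \<open>m\<close>, and \<open>e\<close> is congruent to \<open>m\<close>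
  modulo it; hence every prime factor of \<open>q ^ m - 1\<close> divides \<open>e\<close> (\<open>prime_dvd_geometric_sum\<close>).
  If \<open>x\<close> is primitive, then \<open>a\<close>, being a root of unity of order dividing \<open>q - 1\<close>, is a power of \<open>x\<close>
  whose exponent \<open>j\<close> is a multiple of \<open>e\<close>. Therefore \<open>j + 1\<close> is prime to \<open>q ^ m - 1\<close>, and
  \<open>a x = x ^ (j + 1)\<close> is again primitive (\<open>ord_mult_generator\<close>).

  The trace is \<open>K\<close>-linear, so multiplication by \<open>d / c\<close> carries the primitive elements of trace \<open>c\<close>
  to those of trace \<open>d\<close>: all nonzero traces occur equally often (\<open>Z_primitive_eq\<close>). Since the
  trace takes its values in \<open>K\<close> (\<open>ff_trace_mem_subfield\<close>), which has \<open>q - 1\<close> nonzero elements, and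
  since there are \<open>\<phi>(q ^ m - 1)\<close> primitive elements altogether, the formula follows.

  That the trace lies in \<open>K\<close> rests on two facts: \<open>K\<close> is the set of fixed points of \<open>x \<mapsto> x ^ q\<close>
  (\<open>mem_subfield_iff\<close>), and this map is additive (\<open>frobenius_power_add\<close>), which comes from the
  binomial theorem in a ring of prime characteristic.
\<close>

section \<open>The Frobenius map\<close>

lemma (in cring) binomial:
  assumes x: "x \<in> carrier R" and y: "y \<in> carrier R"
  shows "(x \<oplus> y) [^] (n::nat) = (\<Oplus>k\<in>{..n}. [(n choose k)] \<cdot> (x [^] k \<otimes> y [^] (n - k)))"
proof (induction n)
  case 0
  show ?case using x y by simp
next
  case (Suc n)
  define S where "S = (\<Oplus>k\<in>{..n}. [(n choose k)] \<cdot> (x [^] k \<otimes> y [^] (n - k)))"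
  define f where "f k = [(n choose k)] \<cdot> (x [^] k \<otimes> y [^] (Suc n - k))" for k
  define g where "g k = [(n choose k)] \<cdot> (x [^] Suc k \<otimes> y [^] (n - k))" for k
  have f: "f k \<in> carrier R" and g: "g k \<in> carrier R" for k
    using x y by (auto simp: f_def g_def)
  have S: "S \<in> carrier R" using x y by (auto simp: S_def)
  have "S \<otimes> x = (\<Oplus>k\<in>{..n}. g k)"
    unfolding S_def g_def using x y
    by (subst finsum_ldistr) (auto intro!: finsum_cong' simp: add_pow_ldistr add_pow_rdistr m_ac)
  moreover have "S \<otimes> y = (\<Oplus>k\<in>{..n}. f k)"
    unfolding S_def f_def using x y
    by (subst finsum_ldistr)
      (auto intro!: finsum_cong' simp: add_pow_ldistr m_assoc Suc_diff_le)
  \<comment> \<open>The term of \<open>f\<close> at \<open>Suc n\<close> vanishes, so the sum of \<open>f\<close> can be extended to it and the term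
      at 0 split off; the terms at \<open>Suc k\<close> then combine with \<open>g k\<close> by Pascal's rule.\<close>
  moreover have "(\<Oplus>k\<in>{..n}. f k) = (\<Oplus>k\<in>{..n}. f (Suc k)) \<oplus> f 0"
  proof -
    have "f (Suc n) = \<zero>" using x y by (simp add: f_def binomial_eq_0)
    then have "(\<Oplus>k\<in>{..n}. f k) = (\<Oplus>k\<in>{..Suc n}. f k)"
      using f by (subst finsum_Suc) auto
    then show ?thesis using f by (subst (asm) finsum_Suc2) auto
  qed
  ultimately have "(x \<oplus> y) [^] Suc n =
      ((\<Oplus>k\<in>{..n}. g k) \<oplus> (\<Oplus>k\<in>{..n}. f (Suc k))) \<oplus> f 0"
    using Suc x y S f g unfolding S_def[symmetric]
    by (simp add: r_distr a_assoc)
  also have "(\<Oplus>k\<in>{..n}. g k) \<oplus> (\<Oplus>k\<in>{..n}. f (Suc k)) = (\<Oplus>k\<in>{..n}. g k \<oplus> f (Suc k))"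
    using f g by (subst finsum_addf) auto
  also have "\<dots> = (\<Oplus>k\<in>{..n}. [(Suc n choose Suc k)] \<cdot> (x [^] Suc k \<otimes> y [^] (Suc n - Suc k)))"
    using x y unfolding f_def g_def by (intro finsum_cong') (auto simp: add.nat_pow_mult)
  also have "f 0 = [(Suc n choose 0)] \<cdot> (x [^] (0::nat) \<otimes> y [^] (Suc n - 0))"
    by (simp add: f_def)
  finally show ?case using x y by (subst finsum_Suc2) auto
qed

lemma (in cring) add_pow_eq_zero_of_dvd:
  assumes "[p] \<cdot> \<one> = \<zero>" "(p::nat) dvd n" "x \<in> carrier R"
  shows "[n] \<cdot> x = \<zero>"
proof -
  obtain k where k: "n = p * k" using assms(2) by auto
  have "[p] \<cdot> x = \<zero>" using add_pow_ldistr[of \<one> x p] assms by simp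
  then show ?thesis using add.nat_pow_pow[of x k p] assms(3) by (simp add: k)
qed

text \<open>All inner binomial coefficients are divisible by \<open>p\<close>, and \<open>p\<close> annihilates the ring.\<close>

lemma (in cring) frobenius_add:
  assumes p: "prime p" "[p] \<cdot> \<one> = \<zero>" and x: "x \<in> carrier R" and y: "y \<in> carrier R"
  shows "(x \<oplus> y) [^] (p::nat) = x [^] p \<oplus> y [^] p"
proof -
  obtain r where r: "p = Suc (Suc r)"
    using prime_ge_2_nat[OF p(1)] by (metis add_2_eq_Suc le_Suc_ex)
  have "[(p choose Suc k)] \<cdot> (x [^] Suc k \<otimes> y [^] (p - Suc k)) = \<zero>" if "k \<le> r" for k
  proof (rule add_pow_eq_zero_of_dvd[OF p(2)])
    show "p dvd (p choose Suc k)" using that p(1) r by (intro dvd_choose_prime) auto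
  qed (use x y in simp)
  then have "(\<Oplus>k\<in>{..r}. [(p choose Suc k)] \<cdot> (x [^] Suc k \<otimes> y [^] (p - Suc k))) = \<zero>"
    by (subst finsum_cong'[of "{..r}" "{..r}" "\<lambda>_. \<zero>"]) auto
  then show ?thesis
    unfolding binomial[OF x y] using x y
    by (subst r, subst finsum_Suc, force, subst finsum_Suc2, force) (simp add: r)
qed

lemma (in cring) frobenius_power_add:
  assumes p: "prime p" "[p] \<cdot> \<one> = \<zero>" and x: "x \<in> carrier R" and y: "y \<in> carrier R"
  shows "(x \<oplus> y) [^] ((p::nat) ^ k) = x [^] (p ^ k) \<oplus> y [^] (p ^ k)"
proof (induction k)
  case 0
  show ?case using x y by simp
next
  case (Suc k)
  have "z [^] (p ^ Suc k) = (z [^] (p ^ k)) [^] p" if "z \<in> carrier R" for z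
    using that by (simp add: nat_pow_pow mult.commute)
  then show ?case using Suc p x y by (simp add: frobenius_add)
qed

lemma (in cring) frobenius_power_finsum:
  assumes p: "prime p" "[p] \<cdot> \<one> = \<zero>" and "finite A" and "f \<in> A \<rightarrow> carrier R"
  shows "(\<Oplus>i\<in>A. f i) [^] ((p::nat) ^ k) = (\<Oplus>i\<in>A. f i [^] (p ^ k))"
  using assms(3,4)
proof (induction A rule: finite_induct)
  case empty
  show ?case using prime_gt_0_nat[OF p(1)] by (simp add: nat_pow_zero)
next
  case (insert a A)
  then show ?case using p by (simp add: frobenius_power_add Pi_def)
qed

text \<open>By Lagrange's theorem in the additive group, \<open>p ^ n\<close> annihilates \<open>\<one>\<close>; since the
  \<open>n\<close>-th power of \<open>[p] \<cdot> \<one>\<close> is \<open>[p ^ n] \<cdot> \<one>\<close>, the absence of zero divisors gives the claim.\<close>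

lemma (in domain) add_pow_prime_eq_zero:
  assumes "card (carrier R) = p ^ n"
  shows "[(p::nat)] \<cdot> \<one> = \<zero>"
proof -
  have pow: "[(p ^ j)] \<cdot> \<one> = ([p] \<cdot> \<one>) [^] j" for j
  proof (induction j)
    case (Suc j)
    have "[(p ^ Suc j)] \<cdot> \<one> = [p] \<cdot> ([(p ^ j)] \<cdot> \<one>)"
      using add.nat_pow_pow[of \<one> p "p ^ j"] by (simp add: mult.commute)
    also have "\<dots> = ([(p ^ j)] \<cdot> \<one>) \<otimes> ([p] \<cdot> \<one>)"
      using add_pow_rdistr[of "[(p ^ j)] \<cdot> \<one>" \<one> p] by simp
    finally show ?case using Suc by simp
  qed simp
  have "[(p ^ n)] \<cdot> \<one> = \<zero>"
    using add.pow_order_eq_1[of \<one>] assms by (simp add: order_def)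
  then have z: "([p] \<cdot> \<one>) [^] n = \<zero>" by (simp add: pow)
  have "c = \<zero>" if "c \<in> carrier R" "c [^] j = \<zero>" for c and j :: nat
    using that by (induction j) (auto simp: integral_iff)
  then show ?thesis using z by blast
qed

section \<open>The trace\<close>

lemma (in field) pow_card_eq_self:
  assumes fin: "finite (carrier R)" and x: "x \<in> carrier R"
  shows "x [^] card (carrier R) = x"
proof (cases "x = \<zero>")
  case True
  have "card (carrier R) \<noteq> 0" using fin x by auto
  then show ?thesis using True by (simp add: nat_pow_zero)
next
  case False
  interpret G: group "Multiplicative_Group.mult_of R" by (rule field_mult_group)
  have "x [^] (card (carrier R) - 1) = \<one>"
    using G.pow_order_eq_1[of x] x False order_mult_of[OF fin]
    by (simp add: Multiplicative_Group.mult_of_simps order_def)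
  moreover have "card (carrier R) = Suc (card (carrier R) - 1)"
    using fin x card_gt_0_iff[of "carrier R"] by auto
  ultimately show ?thesis using x by (metis nat_pow_Suc l_one)
qed

lemma (in field) subfield_pow_card:
  assumes "subfield K R" "finite K" "x \<in> K"
  shows "x [^] card K = x"
proof -
  interpret K: field "R\<lparr>carrier := K\<rparr>" using subfield_iff(2)[OF assms(1)] .
  show ?thesis using K.pow_card_eq_self[of x] assms(2,3) by (simp add: nat_pow_consistent[symmetric])
qed

text \<open>The elements of \<open>K\<close> satisfy \<open>x ^ q = x\<close>, and this equation has no more than \<open>q\<close> solutions:
  zero and at most \<open>q - 1\<close> roots of \<open>x ^ (q - 1) = 1\<close>.\<close>

lemma (in field) mem_subfield_iff:
  assumes fin: "finite (carrier R)" and K: "subfield K R" and x: "x \<in> carrier R"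
  shows "x \<in> K \<longleftrightarrow> x [^] card K = x"
proof
  assume "x \<in> K"
  then show "x [^] card K = x"
    using subfield_pow_card[OF K] finite_subset[OF subfieldE(3)[OF K] fin] by simp
next
  assume xK: "x [^] card K = x"
  have sub: "K \<subseteq> carrier R" and finK: "finite K"
    using subfieldE(3)[OF K] fin finite_subset by auto
  have zero: "\<zero> \<in> K" and one: "\<one> \<in> K"
    using subringE(2,3)[OF subfieldE(1)[OF K]] by auto
  define d where "d = card K - 1"
  have "card {\<zero>, \<one>} \<le> card K" using zero one finK by (intro card_mono) auto
  then have d: "card K = Suc d" "d \<noteq> 0" by (auto simp: d_def)
  have root: "z [^] d = \<one>" if "z \<in> carrier R" "z [^] card K = z" "z \<noteq> \<zero>" for z
    using that m_rcancel[of z "z [^] d" \<one>] by (simp add: d)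
  let ?A = "{z \<in> carrier R. z [^] d = \<one>}"
  have "K - {\<zero>} \<subseteq> ?A" using root subfield_pow_card[OF K finK] sub by auto
  moreover have "card ?A \<le> card (K - {\<zero>})"
    using num_roots_le_deg[OF fin d(2)] zero finK by (simp add: d)
  ultimately have "K - {\<zero>} = ?A" using fin by (intro card_seteq) auto
  then show "x \<in> K" using root[OF x xK] x zero by (cases "x = \<zero>") auto
qed

text \<open>Raising the trace to the \<open>q\<close>-th power permutes its summands cyclically.\<close>

lemma (in field) ff_trace_mem_subfield:
  assumes K: "subfield K R" and q: "card K = q" "primepow q"
    and card: "card (carrier R) = q ^ m" "m > 0" and x: "x \<in> carrier R"
  shows "ff_trace R q m x \<in> K"
proof -
  obtain p k where p: "prime p" "q = p ^ k"
    using q(2) by (auto simp: primepow_def)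
  have "q > 0" using q(2) primepow_gt_0_nat by blast
  then have "card (carrier R) > 0" by (simp add: card)
  then have fin: "finite (carrier R)" using card_gt_0_iff by blast
  have char: "[p] \<cdot> \<one> = \<zero>"
    using add_pow_prime_eq_zero[of p "k * m"] by (simp add: card p power_mult)
  obtain n where m: "m = Suc n" using card(2) gr0_implies_Suc by blast
  define T where "T = (\<Oplus>i\<in>{..n}. x [^] (q ^ i))"
  have T: "ff_trace R q m x = T" "T \<in> carrier R"
    using x by (auto simp: ff_trace_def T_def m lessThan_Suc_atMost)
  have "T [^] q = (\<Oplus>i\<in>{..n}. (x [^] (q ^ i)) [^] q)"
    unfolding T_def p(2) using x by (intro frobenius_power_finsum p char) auto
  also have "\<dots> = (\<Oplus>i\<in>{..n}. x [^] (q ^ Suc i))"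
    using x by (intro finsum_cong') (auto simp: nat_pow_pow mult.commute)
  \<comment> \<open>The sum over \<open>i \<le> n + 1\<close> is split off at its first and at its last index; both of the terms
      split off equal \<open>x\<close>, since \<open>x ^ (q ^ m) = x\<close>.\<close>
  finally have "T [^] q \<oplus> x [^] (q ^ 0) = (\<Oplus>i\<in>{..Suc n}. x [^] (q ^ i))"
    using x by (subst finsum_Suc2) auto
  also have "\<dots> = x [^] (q ^ Suc n) \<oplus> T"
    unfolding T_def using x by (subst finsum_Suc) auto
  also have "x [^] (q ^ Suc n) = x"
    using pow_card_eq_self[OF fin x] by (simp add: card m)
  finally have "T [^] q \<oplus> x = T \<oplus> x" using x T by (simp add: a_comm)
  then have "T [^] q = T" using x T by simp
  then show ?thesis using mem_subfield_iff[OF fin K] T q by simp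
qed

lemma (in field) ff_trace_smult:
  assumes K: "subfield K R" and q: "card K = q" "finite K"
    and a: "a \<in> K" and x: "x \<in> carrier R"
  shows "ff_trace R q m (a \<otimes> x) = a \<otimes> ff_trace R q m x"
proof -
  have ac: "a \<in> carrier R" using a subfieldE(3)[OF K] by auto
  have fixed: "a [^] (q ^ i) = a" for i
  proof (induction i)
    case (Suc i)
    have "a [^] (q ^ Suc i) = (a [^] (q ^ i)) [^] q"
      using ac by (simp add: nat_pow_pow mult.commute)
    then show ?case using Suc subfield_pow_card[OF K q(2) a] q by simp
  qed (use ac in simp)
  have "ff_trace R q m (a \<otimes> x) = (\<Oplus>i\<in>{..<m}. a \<otimes> x [^] (q ^ i))"
    unfolding ff_trace_def using ac x
    by (intro finsum_cong') (auto simp: nat_pow_distrib fixed)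
  also have "\<dots> = a \<otimes> ff_trace R q m x"
    unfolding ff_trace_def using ac x by (subst finsum_rdistr) auto
  finally show ?thesis .
qed

section \<open>Primitive elements\<close>

lemma (in field) primitive_element_iff_ord:
  assumes fin: "finite (carrier R)"
  shows "primitive_element R x \<longleftrightarrow>
    x \<in> carrier (Multiplicative_Group.mult_of R) \<and>
    group.ord (Multiplicative_Group.mult_of R) x = order (Multiplicative_Group.mult_of R)"
proof -
  interpret G: group "Multiplicative_Group.mult_of R" by (rule field_mult_group)
  have finG: "finite (carrier (Multiplicative_Group.mult_of R))" using fin by (rule finite_mult_of)
  have "generate (Multiplicative_Group.mult_of R) {x} = carrier (Multiplicative_Group.mult_of R)
      \<longleftrightarrow> G.ord x = order (Multiplicative_Group.mult_of R)"
    if x: "x \<in> carrier (Multiplicative_Group.mult_of R)"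
    using x G.generate_incl[of "{x}"] card_subset_eq[OF finG]
    unfolding G.generate_pow_card[OF x] order_def by auto
  then show ?thesis unfolding primitive_element_def by blast
qed

text \<open>The multiplicative group is cyclic, so the primitive elements are the powers of one generator
  with exponent prime to the group order.\<close>

lemma (in field) card_primitive_elements:
  assumes fin: "finite (carrier R)"
  shows "card {x \<in> carrier R. primitive_element R x} = totient (card (carrier R) - 1)"
proof -
  let ?G = "Multiplicative_Group.mult_of R"
  interpret G: group ?G by (rule field_mult_group)
  have finG: "finite (carrier ?G)" using fin by (rule finite_mult_of)
  obtain g where g: "g \<in> carrier ?G" "carrier ?G = {g [^] i | i::nat. i \<in> UNIV}"
    using finite_field_mult_group_has_gen[OF fin] by blast
  have "generate ?G {g} = carrier ?G"
    using G.generate_pow_on_finite_carrier[OF finG g(1)] g(2)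
    by (simp add: Multiplicative_Group.nat_pow_mult_of)
  then have "G.ord g = order ?G"
    using G.generate_pow_card[OF g(1)] by (simp add: order_def)
  then have "card {x \<in> carrier ?G. G.ord x = order ?G} = phi' (order ?G)"
    using g(1) by (intro num_elems_of_ord_eq_phi'[OF fin]) auto
  also have "{x \<in> carrier ?G. G.ord x = order ?G} = {x \<in> carrier R. primitive_element R x}"
    using primitive_element_iff_ord[OF fin] by auto
  also have "phi' (order ?G) = totient (card (carrier R) - 1)"
    unfolding phi'_def totient_def totatives_def order_mult_of[OF fin] order_def
    by (intro arg_cong[where f = card]) auto
  finally show ?thesis .
qed

text \<open>Write \<open>a = x ^ j\<close>. Since \<open>a ^ d = 1\<close>, the number \<open>e\<close> divides \<open>j\<close>, so every prime dividing the
  group order divides \<open>j\<close> and \<open>a \<cdot> x = x ^ (j + 1)\<close> has an exponent prime to the order.\<close>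

lemma (in group) ord_mult_generator:
  assumes fin: "finite (carrier G)" and x: "x \<in> carrier G" "ord x = order G"
    and a: "a \<in> carrier G" "a [^] (d::nat) = \<one>" and order: "order G = d * e"
    and radical: "\<And>p. prime p \<Longrightarrow> p dvd order G \<Longrightarrow> p dvd e"
  shows "ord (a \<otimes> x) = order G"
proof -
  have "generate G {x} = carrier G"
    using generate_incl[of "{x}"] generate_pow_card[OF x(1)] x fin
    by (intro card_subset_eq) (auto simp: order_def)
  then obtain j :: nat where j: "a = x [^] j"
    using a(1) generate_pow_on_finite_carrier[OF fin x(1)] by auto
  have "d > 0" using fin order order_gt_0_iff_finite by auto
  have "x [^] (j * d) = \<one>" using a(2) x(1) by (simp add: j nat_pow_pow)
  then have "d * e dvd j * d" using pow_eq_id[OF x(1)] x(2) order by simp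
  then have "e dvd j" using \<open>d > 0\<close> by (simp add: mult.commute)
  have "coprime (Suc j) (order G)"
  proof (rule ccontr)
    assume "\<not> coprime (Suc j) (order G)"
    then obtain p where p: "prime p" "p dvd Suc j" "p dvd order G"
      using prime_factor_nat[of "gcd (Suc j) (order G)"] by (auto simp: coprime_iff_gcd_eq_1)
    then have "p dvd j" using radical \<open>e dvd j\<close> dvd_trans by blast
    then have "p dvd 1" using p(2) dvd_diff_nat[of p "Suc j" j] by simp
    then show False using p(1) by simp
  qed
  then have "ord (x [^] Suc j) = order G"
    using pow_ord_eq_ord_iff[OF fin x(1), of "Suc j"] x(2) by (simp del: nat_pow_Suc)
  then show ?thesis by (simp add: j)
qed

section \<open>Counting by trace\<close>

lemma power_minus_one_eq_geometric_sum:
  fixes q m :: nat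
  assumes "q > 0"
  shows "q ^ m - 1 = (q - 1) * (\<Sum>i<m. q ^ i)"
proof -
  obtain r where "q = Suc r" using assms gr0_implies_Suc by blast
  moreover have "Suc r ^ m = Suc (r * (\<Sum>i<m. Suc r ^ i))"
    by (induction m) (auto simp: algebra_simps)
  ultimately show ?thesis by simp
qed

text \<open>Modulo a prime factor of \<open>q - 1\<close> every summand is 1, so the sum is congruent to \<open>m\<close>.\<close>

lemma prime_dvd_geometric_sum:
  fixes q m p :: nat
  assumes q: "q > 0" and radical: "\<And>p. prime p \<Longrightarrow> p dvd q - 1 \<Longrightarrow> p dvd m"
    and p: "prime p" "p dvd q ^ m - 1"
  shows "p dvd (\<Sum>i<m. q ^ i)"
proof (cases "p dvd q - 1")
  case True
  then have "[q = 1] (mod p)" using q by (simp add: cong_altdef_nat cong_sym_eq)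
  then have "[q ^ i = 1] (mod p)" for i using cong_pow[of q 1 p i] by simp
  then have "[(\<Sum>i<m. q ^ i) = (\<Sum>i<m. 1)] (mod p)" by (intro cong_sum) auto
  then show ?thesis using radical[OF p(1) True] by (simp add: cong_dvd_iff)
next
  case False
  then show ?thesis
    using p power_minus_one_eq_geometric_sum[OF q, of m] by (simp add: prime_dvd_mult_iff)
qed

lemma (in field) primitive_element_smult:
  assumes K: "subfield K R" "card K = q" "q > 0" and card: "card (carrier R) = q ^ m"
    and radical: "\<And>p. prime p \<Longrightarrow> p dvd q - 1 \<Longrightarrow> p dvd m"
    and a: "a \<in> K - {\<zero>}" and x: "primitive_element R x"
  shows "primitive_element R (a \<otimes> x)"
proof -
  let ?G = "Multiplicative_Group.mult_of R"
  interpret G: group ?G by (rule field_mult_group)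
  have "card (carrier R) > 0" using K(3) by (simp add: card)
  then have fin: "finite (carrier R)" using card_gt_0_iff by blast
  have finK: "finite K" using K(2,3) card_gt_0_iff by blast
  have order: "order ?G = q ^ m - 1" by (simp add: order_mult_of[OF fin] order_def card)
  have xG: "x \<in> carrier ?G" "G.ord x = order ?G"
    using x primitive_element_iff_ord[OF fin] by auto
  have ac: "a \<in> carrier R" "a \<noteq> \<zero>" using a subfieldE(3)[OF K(1)] by auto
  have "a [^] (q - 1) \<otimes> a = \<one> \<otimes> a"
    using subfield_pow_card[OF K(1) finK, of a] a ac K(2,3)
    by (metis DiffD1 Suc_diff_1 l_one nat_pow_Suc)
  then have "a [^] (q - 1) = \<one>" using ac m_rcancel[of a "a [^] (q - 1)" \<one>] by simp
  then have "a [^]\<^bsub>?G\<^esub> (q - 1) = \<one>\<^bsub>?G\<^esub>" by (simp add: Multiplicative_Group.nat_pow_mult_of)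
  moreover have "order ?G = (q - 1) * (\<Sum>i<m. q ^ i)"
    unfolding order by (rule power_minus_one_eq_geometric_sum[OF K(3)])
  moreover have "p dvd (\<Sum>i<m. q ^ i)" if "prime p" "p dvd order ?G" for p
    using prime_dvd_geometric_sum[OF K(3) radical] that order by simp
  moreover have "a \<in> carrier ?G" using ac by simp
  ultimately have "G.ord (a \<otimes>\<^bsub>?G\<^esub> x) = order ?G"
    using G.ord_mult_generator[OF finite_mult_of[OF fin] xG] by blast
  then show ?thesis
    using xG(1) ac G.m_closed[of a x] by (simp add: primitive_element_iff_ord[OF fin])
qed

text \<open>Only one inequality is stated, because applying it to \<open>a = d / c\<close> and to \<open>a = c / d\<close> gives
  equality of the counts for \<open>c\<close> and \<open>d\<close>.\<close>

lemma (in field) Z_primitive_le_smult: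
  assumes K: "subfield K R" "card K = q" "q > 0" and card: "card (carrier R) = q ^ m"
    and radical: "\<And>p. prime p \<Longrightarrow> p dvd q - 1 \<Longrightarrow> p dvd m"
    and a: "a \<in> K - {\<zero>}"
  shows "Z_primitive R q m c \<le> Z_primitive R q m (a \<otimes> c)"
  unfolding Z_primitive_def
proof (rule card_inj_on_le)
  have "card (carrier R) > 0" using K(3) by (simp add: card)
  then have fin: "finite (carrier R)" using card_gt_0_iff by blast
  then show "finite {x \<in> carrier R. primitive_element R x \<and> ff_trace R q m x = a \<otimes> c}" by simp
  have finK: "finite K" using K(2,3) card_gt_0_iff by blast
  have ac: "a \<in> carrier R" "a \<noteq> \<zero>" using a subfieldE(3)[OF K(1)] by auto
  then show "inj_on (\<lambda>x. a \<otimes> x) {x \<in> carrier R. primitive_element R x \<and> ff_trace R q m x = c}"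
    using m_lcancel[of a] by (intro inj_onI) blast
  show "(\<lambda>x. a \<otimes> x) ` {x \<in> carrier R. primitive_element R x \<and> ff_trace R q m x = c}
      \<subseteq> {x \<in> carrier R. primitive_element R x \<and> ff_trace R q m x = a \<otimes> c}"
  proof (intro image_subsetI CollectI conjI)
    fix x assume "x \<in> {x \<in> carrier R. primitive_element R x \<and> ff_trace R q m x = c}"
    then have x: "x \<in> carrier R" "primitive_element R x" "ff_trace R q m x = c" by auto
    show "a \<otimes> x \<in> carrier R" using ac x by simp
    show "primitive_element R (a \<otimes> x)"
      using primitive_element_smult[OF K card radical a x(2)] .
    show "ff_trace R q m (a \<otimes> x) = a \<otimes> c"
      using ff_trace_smult[OF K(1,2) finK _ x(1)] a x(3) by simp
  qed
qed

lemma (in field) Z_primitive_eq: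
  assumes K: "subfield K R" "card K = q" "q > 0" and card: "card (carrier R) = q ^ m"
    and radical: "\<And>p. prime p \<Longrightarrow> p dvd q - 1 \<Longrightarrow> p dvd m"
    and c: "c \<in> K - {\<zero>}" and d: "d \<in> K - {\<zero>}"
  shows "Z_primitive R q m c = Z_primitive R q m d"
proof -
  have "Z_primitive R q m c \<le> Z_primitive R q m d" if "c \<in> K - {\<zero>}" "d \<in> K - {\<zero>}" for c d
  proof -
    have cd: "c \<in> carrier R" "d \<in> carrier R" "c \<noteq> \<zero>" "d \<noteq> \<zero>"
      using that subfieldE(3)[OF K(1)] by auto
    have ic: "inv c \<in> K - {\<zero>}" "c \<otimes> inv c = \<one>"
      using subfield_m_inv[OF K(1) that(1)] by auto
    then have icc: "inv c \<in> carrier R" using subfieldE(3)[OF K(1)] by auto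
    have "d \<otimes> inv c \<in> K - {\<zero>}"
      using that ic subringE(6)[OF subfieldE(1)[OF K(1)]] cd icc by (auto simp: integral_iff)
    moreover have "(d \<otimes> inv c) \<otimes> c = d" using cd ic icc m_comm[of c "inv c"] by (simp add: m_assoc)
    ultimately show ?thesis
      using Z_primitive_le_smult[OF K card radical, of "d \<otimes> inv c" c] by simp
  qed
  from this[OF c d] this[OF d c] show ?thesis by simp
qed

lemma (in field) sum_Z_primitive:
  assumes K: "subfield K R" "card K = q" "primepow q"
    and card: "card (carrier R) = q ^ m" "m > 0"
  shows "(\<Sum>c\<in>K. Z_primitive R q m c) = totient (q ^ m - 1)"
proof -
  have "q > 0" using K(3) primepow_gt_0_nat by blast
  then have "card (carrier R) > 0" by (simp add: card)
  then have fin: "finite (carrier R)" using card_gt_0_iff by blast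
  have finK: "finite K" using fin subfieldE(3)[OF K(1)] finite_subset by blast
  let ?P = "{x \<in> carrier R. primitive_element R x}"
  have "(\<Sum>c\<in>K. Z_primitive R q m c) = (\<Sum>c\<in>K. card {x \<in> ?P. ff_trace R q m x = c})"
    by (simp add: Z_primitive_def conj_assoc)
  also have "\<dots> = card (\<Union>c\<in>K. {x \<in> ?P. ff_trace R q m x = c})"
    using fin finK by (intro card_UN_disjoint[symmetric]) auto
  also have "(\<Union>c\<in>K. {x \<in> ?P. ff_trace R q m x = c}) = ?P"
    using ff_trace_mem_subfield[OF K card] by auto
  finally show ?thesis using card_primitive_elements[OF fin] by (simp add: card)
qed

section \<open>The number of primitive elements of given nonzero trace\<close>

theorem corollary5p3:
  fixes L :: "('a, 'b) ring_scheme" and K :: "'a set" and q m :: nat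
  assumes "primepow q" and "m > 0"
    and "field L" and "card (carrier L) = q ^ m"
    and "subfield K L" and "card K = q"
    and "\<And>p. prime p \<Longrightarrow> p dvd q - 1 \<Longrightarrow> p dvd m"
  shows "\<forall>c \<in> K - {\<zero>\<^bsub>L\<^esub>}.
           real (Z_primitive L q m c) =
             (real (totient (q ^ m - 1)) - real (Z_primitive L q m \<zero>\<^bsub>L\<^esub>)) / (real q - 1)"
proof
  fix c assume c: "c \<in> K - {\<zero>\<^bsub>L\<^esub>}"
  interpret field L by fact
  have q: "q > 1" using assms(1) primepow_gt_Suc_0 by auto
  then have finK: "finite K" using assms(6) card_gt_0_iff by force
  have zero: "\<zero>\<^bsub>L\<^esub> \<in> K" using subringE(2)[OF subfieldE(1)[OF assms(5)]] .
  have "totient (q ^ m - 1) = (\<Sum>d\<in>K. Z_primitive L q m d)"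
    using sum_Z_primitive assms by simp
  also have "\<dots> = Z_primitive L q m \<zero>\<^bsub>L\<^esub> + (\<Sum>d\<in>K - {\<zero>\<^bsub>L\<^esub>}. Z_primitive L q m d)"
    using finK zero by (rule sum.remove)
  also have "(\<Sum>d\<in>K - {\<zero>\<^bsub>L\<^esub>}. Z_primitive L q m d) =
      (\<Sum>d\<in>K - {\<zero>\<^bsub>L\<^esub>}. Z_primitive L q m c)"
    using Z_primitive_eq[OF assms(5,6) _ assms(4,7) _ c] q by (intro sum.cong) auto
  also have "\<dots> = (q - 1) * Z_primitive L q m c"
    using finK zero assms(6) by simp
  finally have "real (totient (q ^ m - 1)) =
      real (Z_primitive L q m \<zero>\<^bsub>L\<^esub>) + (real q - 1) * real (Z_primitive L q m c)"
    using q by (simp add: of_nat_diff)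
  then show "real (Z_primitive L q m c) =
      (real (totient (q ^ m - 1)) - real (Z_primitive L q m \<zero>\<^bsub>L\<^esub>)) / (real q - 1)"
    using q by (simp add: field_simps)
qed

end
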